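(* For any Dyck path $d$ of semilength $n$, $\{\mathrm{Des}(d,\sigma)\mid \sigma\in M_d\} = \{\mathrm{Des}(b,\delta_n)\mid b\in B_d\}$, where $\delta_n=n(n-1)\cdots 1$.
   Context: A Dyck path of semilength $n$ is a lattice path from $(0,0)$ to $(2n,0)$ with steps $U=(1,1)$ and $D=(1,-1)$ never going below the $x$-axis. A peak is an occurrence of $UD$, a valley an occurrence of $DU$; $\mathrm{pk}(e)$ is the number of peaks of $e$. The bounce path of $d$: start at $(0,0)$, take up-steps until reaching a point of $d$ where $d$'s next step is a down-step, then take down-steps to the $x$-axis, then up-steps until again meeting a down-step of $d$, and so on until $(2n,0)$; $\mathrm{bpk}(d)$ is the number of its peaks. For $\sigma=\sigma_1\cdots\sigma_n\in\mathfrak{S}_n$, $\mathrm{can}(d,\sigma)$ is the word of length $2n$ obtained by labeling the $i$-th up-step and the $i$-th down-step of $d$ with $\sigma_i$ and reading left to right; $\mathrm{Des}(d,\sigma)=\{j\in[2n-1]\mid \mathrm{can}(d,\sigma)_j>\mathrm{can}(d,\sigma)_{j+1}\}$ and $\mathrm{des}(d,\sigma)=|\mathrm{Des}(d,\sigma)|$; $m_d=\max_\sigma\mathrm{des}(d,\sigma)$, $M_d=\{\sigma\in\mathfrak{S}_n\mid\mathrm{des}(d,\sigma)=m_d\}$. A Dyck path $b$ is under $d$ if $b$ lies weakly below $d$. $B_d$ is the set of Dyck paths $b$ of semilength $n$ such that: $b$ is under $d$; $\mathrm{pk}(b)=\mathrm{bpk}(d)$ and every peak (top vertex) of $b$ lies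 on $d$; and every valley (bottom vertex) of $b$ is either a valley of $d$ or lies on the $x$-axis. *)

theory Defs
  imports Main "HOL-Combinatorics.Permutations"
begin

datatype step = Up | Down

type_synonym path = "step list"

definition height :: "path \<Rightarrow> nat \<Rightarrow> int" where
  "height d i = int (count_list (take i d) Up) - int (count_list (take i d) Down)"

definition dyck_path :: "nat \<Rightarrow> path \<Rightarrow> bool" where
  "dyck_path n d \<longleftrightarrow>
     length d = 2 * n \<and> (\<forall>i\<le>2 * n. 0 \<le> height d i) \<and> height d (2 * n) = 0"

definition vertices :: "path \<Rightarrow> (nat \<times> int) set" where
  "vertices d = {(i, height d i) | i. i \<le> length d}"

text \<open>Peaks and valleys are identified with their top and bottom vertices, respectively.\<close>

definition peaks :: "path \<Rightarrow> (nat \<times> int) set" where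
  "peaks d = {(Suc i, height d (Suc i)) | i. Suc i < length d \<and> d ! i = Up \<and> d ! Suc i = Down}"

definition valleys :: "path \<Rightarrow> (nat \<times> int) set" where
  "valleys d = {(Suc i, height d (Suc i)) | i. Suc i < length d \<and> d ! i = Down \<and> d ! Suc i = Up}"

definition pk :: "path \<Rightarrow> nat" where
  "pk d = card (peaks d)"

text \<open>The number of up-steps the bounce path takes when it leaves the \<open>x\<close>-axis at \<open>(x, 0)\<close>:
  it stops at the first vertex \<open>(x + k, k)\<close> of \<open>d\<close> that is followed by a down-step of \<open>d\<close>.\<close>

definition bounce_rise :: "path \<Rightarrow> nat \<Rightarrow> nat" where
  "bounce_rise d x =
     (LEAST k. x + k < length d \<and> height d (x + k) = int k \<and> d ! (x + k) = Down)"

text \<open>The part of the bounce path of \<open>d\<close> that starts at \<open>(x, 0)\<close>. The test \<open>0 < bounce_rise d x\<close>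
  only serves termination on arbitrary step lists; it always succeeds when \<open>d\<close> is a
  Dyck path and \<open>x < length d\<close> is even, since a vertex of \<open>d\<close> on the \<open>x\<close>-axis cannot be followed by a
  down-step.\<close>

function bounce_from :: "path \<Rightarrow> nat \<Rightarrow> path" where
  "bounce_from d x =
     (if x < length d \<and> 0 < bounce_rise d x
      then replicate (bounce_rise d x) Up @ replicate (bounce_rise d x) Down
             @ bounce_from d (x + 2 * bounce_rise d x)
      else [])"
  by pat_completeness auto
termination
  by (relation "measure (\<lambda>(d, x). length d - x)") auto

declare bounce_from.simps [simp del]

definition bounce_path :: "path \<Rightarrow> path" where
  "bounce_path d = bounce_from d 0"

definition bpk :: "path \<Rightarrow> nat" where
  "bpk d = pk (bounce_path d)"

text \<open>If the step at list index \<open>j\<close> is the \<open>i\<close>-th up-step (or the \<open>i\<close>-th down-step) of \<open>d\<close>, with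
  \<open>i\<close> counted from 1, then \<open>i = count_list (take (Suc j) d) (d ! j)\<close>.\<close>

definition can :: "path \<Rightarrow> (nat \<Rightarrow> nat) \<Rightarrow> nat list" where
  "can d \<sigma> = map (\<lambda>j. \<sigma> (count_list (take (Suc j) d) (d ! j))) [0..<length d]"

text \<open>Descent positions are counted from 1, list indices from 0.\<close>

definition Des :: "path \<Rightarrow> (nat \<Rightarrow> nat) \<Rightarrow> nat set" where
  "Des d \<sigma> = {j \<in> {1..<length d}. can d \<sigma> ! (j - 1) > can d \<sigma> ! j}"

definition des :: "path \<Rightarrow> (nat \<Rightarrow> nat) \<Rightarrow> nat" where
  "des d \<sigma> = card (Des d \<sigma>)"

definition max_des :: "nat \<Rightarrow> path \<Rightarrow> nat" where
  "max_des n d = Max {des d \<sigma> | \<sigma>. \<sigma> permutes {1..n}}"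

definition M :: "nat \<Rightarrow> path \<Rightarrow> (nat \<Rightarrow> nat) set" where
  "M n d = {\<sigma>. \<sigma> permutes {1..n} \<and> des d \<sigma> = max_des n d}"

definition under :: "path \<Rightarrow> path \<Rightarrow> bool" where
  "under b d \<longleftrightarrow> length b = length d \<and> (\<forall>i\<le>length d. height b i \<le> height d i)"

definition B :: "nat \<Rightarrow> path \<Rightarrow> path set" where
  "B n d = {b. dyck_path n b \<and> under b d \<and> pk b = bpk d \<and> peaks b \<subseteq> vertices d \<and>
               (\<forall>v\<in>valleys b. v \<in> valleys d \<or> snd v = 0)}"

text \<open>The permutation with one-line notation \<open>n (n - 1) \<dots> 1\<close>, extended by the identity
  outside \<open>{1..n}\<close> as \<open>permutes\<close> demands.\<close>

definition decreasing_perm :: "nat \<Rightarrow> nat \<Rightarrow> nat" where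
  "decreasing_perm n i = (if i \<in> {1..n} then n + 1 - i else i)"

end

theory Submission
  imports Defs Complex_Main
begin

text \<open>
  Under \<open>decreasing_perm\<close> the non-descents of a Dyck path are exactly its peaks, so the theorem is
  about the sets \<open>A\<close> of non-descents (cuts) of \<open>can d \<sigma>\<close> of minimal size. Since the two occurrences
  of a label are equal, every interval from the \<open>i\<close>-th up-step to the \<open>i\<close>-th down-step contains a
  cut. The bounce path picks out greedily \<open>bpk d\<close> pairwise disjoint intervals among these, so
  \<open>bpk d\<close> cuts are necessary, and if there are no more, every cut is the only one in some interval.

  Between consecutive cuts the labels decrease strictly. Sorting every such segment of \<open>d\<close>, down-steps
  first, gives the path \<open>b\<close>; its valley in an unsorted segment must lie on the axis, since otherwise
  three labels would form a cycle of strict inequalities. Conversely, given \<open>b\<close>, the inequalities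
  required between consecutive peaks of \<open>b\<close> are satisfied by choosing the values of the labels one
  by one.
\<close>

section \<open>Counting steps\<close>

definition cnt :: "path \<Rightarrow> step \<Rightarrow> nat \<Rightarrow> nat" where
  "cnt d s x = count_list (take x d) s"

text \<open>The index is counted from 0 while \<open>i\<close> is counted from 1. The inequality,
  rather than an equation, inside \<open>LEAST\<close> is the form that
  \<open>step_pos_less_iff\<close> needs.\<close>

definition step_pos :: "path \<Rightarrow> step \<Rightarrow> nat \<Rightarrow> nat" where
  "step_pos d s i = (LEAST p. i \<le> cnt d s (Suc p))"

definition label :: "path \<Rightarrow> nat \<Rightarrow> nat" where
  "label d p = cnt d (d ! p) (Suc p)"

lemma cnt_0 [simp]: "cnt d s 0 = 0"
  by (simp add: cnt_def)

lemma cnt_Suc: "x < length d \<Longrightarrow> cnt d s (Suc x) = cnt d s x + (if d ! x = s then 1 else 0)"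
  by (simp add: cnt_def take_Suc_conv_app_nth)

lemma cnt_beyond: "length d \<le> x \<Longrightarrow> cnt d s x = count_list d s"
  by (simp add: cnt_def)

lemma cnt_mono:
  assumes "x \<le> y"
  shows "cnt d s x \<le> cnt d s y"
proof -
  have "cnt d s x \<le> cnt d s (Suc x)" for x
    by (cases "x < length d") (simp_all add: cnt_Suc cnt_beyond)
  then show ?thesis
    using assms by (rule lift_Suc_mono_le)
qed

lemma cnt_Up_Down: "x \<le> length d \<Longrightarrow> cnt d Up x + cnt d Down x = x"
proof (induction x)
  case (Suc x)
  then show ?case
    by (cases "d ! x") (simp_all add: cnt_Suc)
qed simp

lemma cnt_const:
  assumes "x \<le> y" "y \<le> length d" "\<And>j. x \<le> j \<Longrightarrow> j < y \<Longrightarrow> d ! j \<noteq> s"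
  shows "cnt d s y = cnt d s x"
  using assms by (induction y rule: dec_induct) (simp_all add: cnt_Suc)

lemma cnt_Lipschitz:
  assumes "x \<le> y" "y \<le> length d"
  shows "cnt d s y \<le> cnt d s x + (y - x)"
  using assms by (induction y rule: dec_induct) (auto simp: cnt_Suc)

lemma height_eq_cnt: "height d x = int (cnt d Up x) - int (cnt d Down x)"
  by (simp add: height_def cnt_def)

lemma cnt_eq_if_height_eq:
  assumes "x \<le> length d" "x \<le> length b" "height b x = height d x"
  shows "cnt b s x = cnt d s x"
  using cnt_Up_Down[OF assms(1)] cnt_Up_Down[OF assms(2)] assms(3)
  by (cases s) (simp_all add: height_eq_cnt)

text \<open>This Galois connection between positions and counts is the main translation device
  below: order statements about steps become inequalities between \<open>cnt\<close> values.\<close>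

lemma step_pos_less_iff:
  assumes "1 \<le> i" "i \<le> cnt d s (length d)"
  shows "step_pos d s i < x \<longleftrightarrow> i \<le> cnt d s x"
proof
  have "i \<le> cnt d s (Suc (length d))"
    using assms(2) cnt_mono[of "length d" "Suc (length d)" d s] by simp
  then have "i \<le> cnt d s (Suc (step_pos d s i))"
    unfolding step_pos_def by (rule LeastI)
  moreover assume "step_pos d s i < x"
  ultimately show "i \<le> cnt d s x"
    using cnt_mono[of "Suc (step_pos d s i)" x d s] by simp
next
  assume *: "i \<le> cnt d s x"
  then obtain y where y: "x = Suc y"
    using assms(1) by (cases x) auto
  then have "step_pos d s i \<le> y"
    unfolding step_pos_def using * by (intro Least_le) simp
  then show "step_pos d s i < x"
    using y by simp
qed

lemma step_pos_props:
  assumes "1 \<le> i" "i \<le> cnt d s (length d)"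
  shows "step_pos d s i < length d" "d ! step_pos d s i = s"
    "cnt d s (step_pos d s i) = i - 1" "cnt d s (Suc (step_pos d s i)) = i"
proof -
  let ?p = "step_pos d s i"
  show l: "?p < length d"
    using step_pos_less_iff[OF assms] assms(2) by simp
  have "i \<le> cnt d s (Suc ?p)" "\<not> i \<le> cnt d s ?p"
    using step_pos_less_iff[OF assms] by blast+
  then show "d ! ?p = s" "cnt d s ?p = i - 1" "cnt d s (Suc ?p) = i"
    using cnt_Suc[OF l, of s] by (auto split: if_splits)
qed

lemma step_pos_label:
  assumes "p < length d"
  shows "step_pos d (d ! p) (label d p) = p"
proof -
  have c: "label d p = Suc (cnt d (d ! p) p)"
    using assms by (simp add: label_def cnt_Suc)
  have "label d p \<le> cnt d (d ! p) (length d)"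
    unfolding label_def using assms by (intro cnt_mono) simp
  then have "step_pos d (d ! p) (label d p) < x \<longleftrightarrow> label d p \<le> cnt d (d ! p) x" for x
    using c by (intro step_pos_less_iff) simp_all
  from this[of p] this[of "Suc p"] show ?thesis
    using c by (simp add: label_def)
qed

lemma label_step_pos:
  assumes "1 \<le> i" "i \<le> cnt d s (length d)"
  shows "label d (step_pos d s i) = i"
  using step_pos_props[OF assms] by (simp add: label_def)

lemma can_nth: "p < length d \<Longrightarrow> can d \<sigma> ! p = \<sigma> (label d p)"
  by (simp add: can_def label_def cnt_def)


section \<open>Generic values and standardization\<close>

text \<open>Finite sets with \<open>L\<close> below \<open>H\<close> leave an open interval between
  them, which is infinite and so not exhausted by \<open>X\<close>. Below, \<open>L\<close> and
  \<open>H\<close> hold values of neighbouring labels and \<open>X\<close> the values already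
  taken.\<close>

lemma separating_value:
  fixes L H X :: "real set"
  assumes "finite L" "finite H" "finite X" and LH: "\<And>l h. l \<in> L \<Longrightarrow> h \<in> H \<Longrightarrow> l < h"
  obtains y where "y \<notin> X" "\<And>l. l \<in> L \<Longrightarrow> l < y" "\<And>h. h \<in> H \<Longrightarrow> y < h"
proof -
  obtain a b where ab: "a < b" "\<And>l. l \<in> L \<Longrightarrow> l \<le> a" "\<And>h. h \<in> H \<Longrightarrow> b \<le> h"
  proof (cases "L = {}")
    case True
    obtain b where "\<And>h. h \<in> H \<Longrightarrow> b \<le> h"
      using assms(2) by (cases "H = {}") (auto intro: Min_le)
    then show ?thesis
      using True by (intro that[of "b - 1" b]) auto
  next
    case L: False
    show ?thesis
    proof (cases "H = {}")
      case True
      then show ?thesis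
        using assms(1) by (intro that[of "Max L" "Max L + 1"]) auto
    next
      case False
      then show ?thesis
        using L assms(1,2) LH by (intro that[of "Max L" "Min H"]) auto
    qed
  qed
  have "infinite ({a<..<b} - X)"
    using ab(1) assms(3) by (simp add: infinite_Ioo)
  then have "{a<..<b} - X \<noteq> {}"
    by (rule infinite_imp_nonempty)
  then obtain y where "y \<in> {a<..<b} - X"
    by (auto simp only: ex_in_conv[symmetric])
  then show ?thesis
    using ab(2,3) by (intro that[of y]) fastforce+
qed

text \<open>Standardization: each label is sent to the rank of its value under
  \<open>f\<close>.\<close>

lemma permutation_of_injection:
  fixes f :: "nat \<Rightarrow> real"
  assumes "inj_on f {1..n}"
  obtains \<sigma> where "\<sigma> permutes {1..n}"
    "\<And>i j. i \<in> {1..n} \<Longrightarrow> j \<in> {1..n} \<Longrightarrow> f i < f j \<Longrightarrow> \<sigma> i < \<sigma> j"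
proof -
  define \<sigma> where "\<sigma> i = (if i \<in> {1..n} then card {k \<in> {1..n}. f k \<le> f i} else i)" for i
  have mono: "\<sigma> i < \<sigma> j" if "i \<in> {1..n}" "j \<in> {1..n}" "f i < f j" for i j
  proof -
    have "j \<in> {k \<in> {1..n}. f k \<le> f j} - {k \<in> {1..n}. f k \<le> f i}"
      "{k \<in> {1..n}. f k \<le> f i} \<subseteq> {k \<in> {1..n}. f k \<le> f j}"
      using that by auto
    then have "{k \<in> {1..n}. f k \<le> f i} \<subset> {k \<in> {1..n}. f k \<le> f j}"
      by blast
    then show ?thesis
      using that by (simp add: \<sigma>_def psubset_card_mono)
  qed
  have "inj_on \<sigma> {1..n}"
  proof (rule inj_onI)
    fix i j assume ij: "i \<in> {1..n}" "j \<in> {1..n}" "\<sigma> i = \<sigma> j"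
    then show "i = j"
      using mono[of i j] mono[of j i] inj_onD[OF assms, of i j] by fastforce
  qed
  moreover have "\<sigma> i \<in> {1..n}" if "i \<in> {1..n}" for i
  proof -
    have "card {k \<in> {1..n}. f k \<le> f i} \<le> card {1..n}"
      by (rule card_mono) auto
    moreover have "0 < card {k \<in> {1..n}. f k \<le> f i}"
      using that by (auto simp: card_gt_0_iff)
    ultimately show ?thesis
      using that by (simp add: \<sigma>_def Suc_le_eq)
  qed
  ultimately have "bij_betw \<sigma> {1..n} {1..n}"
    unfolding bij_betw_def by (intro conjI endo_inj_surj image_subsetI) simp_all
  then have "\<sigma> permutes {1..n}"
    by (rule bij_imp_permutes) (auto simp: \<sigma>_def)
  then show ?thesis
    using mono that by blast
qed


section \<open>Peaks of Dyck paths\<close>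

text \<open>The number recorded is the abscissa of the peak and the list index of its down-step.
  This is also the numbering of descent positions, so peaks and non-descents can be compared as
  sets.\<close>

definition peak_positions :: "path \<Rightarrow> nat set" where
  "peak_positions d = {Suc i | i. Suc i < length d \<and> d ! i = Up \<and> d ! Suc i = Down}"

lemma peaks_eq_image: "peaks d = (\<lambda>x. (x, height d x)) ` peak_positions d"
  by (auto simp: peaks_def peak_positions_def)

lemma pk_eq_card: "pk d = card (peak_positions d)"
  unfolding pk_def peaks_eq_image by (rule card_image) (auto simp: inj_on_def)

lemma peak_positions_subset: "peak_positions d \<subseteq> {1..<length d}"
  by (auto simp: peak_positions_def)

lemma peak_positions_Cons:
  "peak_positions (s # d) = (if s = Up \<and> d \<noteq> [] \<and> hd d = Down then {1} else {}) \<union> Suc ` peak_positions d"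
proof (rule set_eqI)
  fix x
  show "x \<in> peak_positions (s # d) \<longleftrightarrow>
    x \<in> (if s = Up \<and> d \<noteq> [] \<and> hd d = Down then {1} else {}) \<union> Suc ` peak_positions d"
  proof (cases x)
    case 0
    then show ?thesis by (auto simp: peak_positions_def)
  next
    case (Suc y)
    show ?thesis
    proof (cases y)
      case 0
      then show ?thesis using Suc by (auto simp: peak_positions_def hd_conv_nth)
    next
      case (Suc z)
      then show ?thesis using \<open>x = Suc y\<close>
        by (auto simp: peak_positions_def image_iff)
    qed
  qed
qed

lemma finite_peak_positions [simp]: "finite (peak_positions d)"
  using peak_positions_subset by (rule finite_subset) simp

lemma pk_Cons: "pk (s # d) = (if s = Up \<and> d \<noteq> [] \<and> hd d = Down then 1 else 0) + pk d"
proof -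
  have "1 \<notin> Suc ` peak_positions d"
    using peak_positions_subset by fastforce
  then show ?thesis
    by (simp add: pk_eq_card peak_positions_Cons card_image)
qed

lemma pk_replicate_Down: "pk (replicate k Down @ d) = pk d"
  by (induction k) (simp_all add: pk_Cons)

text \<open>The block turns from up to down once, and since it ends with a down-step no peak arises
  where \<open>d\<close> is attached.\<close>

lemma pk_bounce:
  assumes "0 < k"
  shows "pk (replicate k Up @ replicate k Down @ d) = Suc (pk d)"
proof -
  have "pk (replicate (Suc j) Up @ Down # d) = Suc (pk (Down # d))" for j d
    by (induction j) (simp_all add: pk_Cons)
  from this[of "k - 1" "replicate (k - 1) Down @ d"] show ?thesis
    using assms by (cases k) (simp_all add: pk_Cons pk_replicate_Down)
qed

text \<open>A down-step right after an up-step would be a peak strictly inside, so after the first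
  up-step only up-steps follow; \<open>z\<close> is the turning vertex.\<close>

lemma no_peak_split:
  assumes "x \<le> y" "y \<le> length b" "peak_positions b \<inter> {x<..<y} = {}"
  obtains z where "x \<le> z" "z \<le> y" "\<And>j. x \<le> j \<Longrightarrow> j < z \<Longrightarrow> b ! j = Down"
    "\<And>j. z \<le> j \<Longrightarrow> j < y \<Longrightarrow> b ! j = Up"
proof -
  have "\<exists>z. x \<le> z \<and> z \<le> y \<and> (\<forall>j. x \<le> j \<and> j < z \<longrightarrow> b ! j = Down) \<and> (\<forall>j. z \<le> j \<and> j < y \<longrightarrow> b ! j = Up)"
    using assms
  proof (induction y rule: dec_induct)
    case base
    then show ?case by auto
  next
    case (step y)
    have "peak_positions b \<inter> {x<..<y} = {}" using step.prems by auto
    then obtain z where z: "x \<le> z" "z \<le> y" "\<forall>j. x \<le> j \<and> j < z \<longrightarrow> b ! j = Down"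
      "\<forall>j. z \<le> j \<and> j < y \<longrightarrow> b ! j = Up"
      using step by auto
    show ?case
    proof (cases "b ! y")
      case Up
      then show ?thesis
        using z by (intro exI[of _ z]) (auto simp: less_Suc_eq)
    next
      case Down
      have "z = y"
      proof (rule ccontr)
        assume "z \<noteq> y"
        then obtain i where i: "y = Suc i" "z \<le> i" using z(2) by (cases y) auto
        then have "y \<in> peak_positions b"
          using z(4) Down step.prems by (auto simp: peak_positions_def)
        then show False using step.prems i z(1) by (auto simp: disjoint_iff)
      qed
      then show ?thesis
        using z Down by (intro exI[of _ "Suc y"]) (auto simp: less_Suc_eq)
    qed
  qed
  then show ?thesis using that by auto
qed

section \<open>Positions and labels in a fixed Dyck path\<close>

locale dyck =
  fixes n :: nat and d :: path
  assumes dyck: "dyck_path n d"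
begin

abbreviation "u \<equiv> cnt d Up"
abbreviation "v \<equiv> cnt d Down"
abbreviation "pU \<equiv> step_pos d Up"
abbreviation "pD \<equiv> step_pos d Down"

lemma length_d: "length d = 2 * n"
  using dyck by (simp add: dyck_path_def)

lemma u_v: "x \<le> 2 * n \<Longrightarrow> u x + v x = x"
  using cnt_Up_Down[of x d] by (simp add: length_d)

lemma v_le_u: "v x \<le> u x"
proof -
  have "v x \<le> u x" if "x \<le> 2 * n" for x
    using dyck that by (simp add: dyck_path_def height_eq_cnt)
  from this[of x] this[of "2 * n"] show ?thesis
    by (cases "x \<le> 2 * n") (simp_all add: cnt_beyond length_d)
qed

lemma cnt_total [simp]: "cnt d s (2 * n) = n"
proof -
  have "u (2 * n) = v (2 * n)"
    using dyck by (simp add: dyck_path_def height_eq_cnt)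
  then show ?thesis
    using u_v[of "2 * n"] by (cases s) simp_all
qed

lemma cnt_le: "cnt d s x \<le> n"
  using cnt_mono[of x "2 * n" d s] cnt_beyond[of d x s] cnt_beyond[of d "2 * n" s] length_d
  by (cases "x \<le> 2 * n") simp_all

lemma pos_less_iff: "i \<in> {1..n} \<Longrightarrow> step_pos d s i < x \<longleftrightarrow> i \<le> cnt d s x"
  by (intro step_pos_less_iff) (simp_all add: length_d)

lemma pos_props:
  assumes "i \<in> {1..n}"
  shows "step_pos d s i < 2 * n" "d ! step_pos d s i = s" "label d (step_pos d s i) = i"
    "cnt d s (step_pos d s i) = i - 1"
  using step_pos_props[of i d s] label_step_pos[of i d s] assms by (simp_all add: length_d)

lemma pos_le_iff: "i \<in> {1..n} \<Longrightarrow> j \<in> {1..n} \<Longrightarrow> step_pos d s i \<le> step_pos d s j \<longleftrightarrow> i \<le> j"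
  using pos_less_iff[of j s "step_pos d s i"] pos_props(4)[of i s] by auto

lemma pos_less_pos_iff: "i \<in> {1..n} \<Longrightarrow> j \<in> {1..n} \<Longrightarrow> step_pos d s i < step_pos d s j \<longleftrightarrow> i < j"
  using pos_le_iff[of j i s] by auto

text \<open>Right after the \<open>i\<close>-th down-step at least \<open>i\<close> up-steps have
  occurred, and that step itself is not one of them.\<close>

lemma pU_less_pD: "i \<in> {1..n} \<Longrightarrow> pU i < pD i"
  using pos_less_iff[of i Up "pD i"] pos_less_iff[of i Down "Suc (pD i)"] v_le_u[of "Suc (pD i)"]
    cnt_Suc[of "pD i" d Up] pos_props[of i Down] length_d by auto

lemma label_range: "p < 2 * n \<Longrightarrow> label d p \<in> {1..n}"
  using cnt_Suc[of p d "d ! p"] cnt_le[of "d ! p" "Suc p"] by (auto simp: label_def length_d)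

lemma pos_label: "p < 2 * n \<Longrightarrow> d ! p = s \<Longrightarrow> step_pos d s (label d p) = p"
  using step_pos_label[of p d] by (auto simp: length_d)

text \<open>A descent here is an increase of the label. Two equal steps raise the label by 1; a
  valley passes from \<open>v\<close> to \<open>u + 1\<close> with \<open>v \<le> u\<close>; only at
  a peak does the label fail to grow, since the number of down-steps after it is at most the number
  of up-steps.\<close>

lemma Des_decreasing_perm: "Des d (decreasing_perm n) = {1..<2 * n} - peak_positions d"
proof -
  have "can d (decreasing_perm n) ! j < can d (decreasing_perm n) ! (j - 1)
      \<longleftrightarrow> j \<notin> peak_positions d" if j: "j \<in> {1..<2 * n}" for j
  proof -
    obtain i where i: "j = Suc i" using j by (cases j) auto
    have r: "label d i \<in> {1..n}" "label d j \<in> {1..n}"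
      using label_range j i by auto
    have "can d (decreasing_perm n) ! j < can d (decreasing_perm n) ! (j - 1) \<longleftrightarrow> label d i < label d j"
      using r i j by (auto simp: can_nth length_d decreasing_perm_def)
    also have "\<dots> \<longleftrightarrow> \<not> (d ! i = Up \<and> d ! j = Down)"
      using i j cnt_Suc[of i d Up] cnt_Suc[of i d Down] cnt_Suc[of j d Up] cnt_Suc[of j d Down]
        v_le_u[of i] v_le_u[of j] v_le_u[of "Suc j"]
      by (cases "d ! i"; cases "d ! j") (auto simp: label_def length_d)
    also have "\<dots> \<longleftrightarrow> j \<notin> peak_positions d"
      using i j by (auto simp: peak_positions_def length_d)
    finally show ?thesis .
  qed
  then show ?thesis
    by (auto simp: Des_def length_d)
qed


section \<open>Non-descents\<close>

definition nondes :: "(nat \<Rightarrow> nat) \<Rightarrow> nat set" where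
  "nondes \<sigma> = {1..<2 * n} - Des d \<sigma>"

text \<open>A cut \<open>a\<close> separates the list positions \<open>a - 1\<close> and \<open>a\<close>.\<close>

definition stabs :: "nat set \<Rightarrow> bool" where
  "stabs A \<longleftrightarrow> A \<subseteq> {1..<2 * n} \<and> (\<forall>i\<in>{1..n}. A \<inter> {pU i<..pD i} \<noteq> {})"

lemma finite_stabs: "stabs A \<Longrightarrow> finite A"
  by (auto simp: stabs_def intro: finite_subset)

lemma nondes_iff:
  "j \<in> nondes \<sigma> \<longleftrightarrow> j \<in> {1..<2 * n} \<and> \<sigma> (label d (j - 1)) \<le> \<sigma> (label d j)"
  by (auto simp: nondes_def Des_def length_d can_nth)

lemma Des_eq_nondes: "Des d \<sigma> = {1..<2 * n} - nondes \<sigma>"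
  by (auto simp: nondes_def Des_def length_d)

lemma des_eq_card_nondes: "des d \<sigma> = 2 * n - 1 - card (nondes \<sigma>)"
  unfolding des_def Des_eq_nondes by (subst card_Diff_subset) (auto simp: nondes_def)

text \<open>This makes the truncated subtraction in \<open>des_eq_card_nondes\<close>
  invertible.\<close>

lemma card_nondes_le: "card (nondes \<sigma>) \<le> 2 * n - 1"
  using card_mono[of "{1..<2 * n}" "nondes \<sigma>"] by (auto simp: nondes_def)

lemma decreasing_on_segment:
  assumes "p < q" "q < 2 * n" "nondes \<sigma> \<inter> {p<..q} = {}"
  shows "\<sigma> (label d q) < \<sigma> (label d p)"
proof -
  have step: "\<sigma> (label d (Suc r)) < \<sigma> (label d r)" if "p \<le> r" "r < q" for r
    using that assms nondes_iff[of "Suc r" \<sigma>] by (auto simp: disjoint_iff)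
  have "Suc p \<le> q" using assms(1) by simp
  then have "q \<le> q \<longrightarrow> \<sigma> (label d q) < \<sigma> (label d p)"
    using step
  proof (induction q rule: dec_induct)
    case (step r)
    from step.prems[of r] step.IH step.prems step.hyps show ?case by fastforce
  qed simp
  then show ?thesis by simp
qed

text \<open>Both ends of the interval carry the label \<open>i\<close>; without a cut the letters
  would decrease strictly from \<open>\<sigma> i\<close> to \<open>\<sigma> i\<close>.\<close>

lemma stabs_nondes: "stabs (nondes \<sigma>)"
  unfolding stabs_def
proof (intro conjI ballI notI)
  show "nondes \<sigma> \<subseteq> {1..<2 * n}"
    by (auto simp: nondes_def)
  fix i assume i: "i \<in> {1..n}" "nondes \<sigma> \<inter> {pU i<..pD i} = {}"
  then show False
    using decreasing_on_segment[of "pU i" "pD i" \<sigma>] pU_less_pD pos_props by simp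
qed

section \<open>Realizing a set of non-descents\<close>

text \<open>Labels are given values one at a time, in the order of the up-steps; the value of a new
  label only has to lie between those of its neighbours in the two segments that contain it.\<close>

lemma nondes_realizable:
  assumes A: "stabs A"
    and noUD: "\<And>t a a' p q. \<lbrakk>t \<in> {1..n}; a \<in> A; a' \<in> A; pU t < a; a \<le> p; p < q; q < a'; a' \<le> pD t;
      d ! p = Up; d ! q = Down\<rbrakk> \<Longrightarrow> A \<inter> {p<..q} \<noteq> {}"
  obtains \<sigma> where "\<sigma> permutes {1..n}" "nondes \<sigma> \<subseteq> A"
proof -
  \<comment> \<open>\<open>R p q\<close> says that \<open>p\<close> precedes \<open>q\<close> in the
    same segment, which forces the value at \<open>p\<close> to exceed the value at
    \<open>q\<close>.\<close>
  define R where "R p q \<longleftrightarrow> p < q \<and> q < 2 * n \<and> A \<inter> {p<..q} = {}" for p q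
  have R_trans: "R p r" if "R p q" "R q r" for p q r
  proof -
    have "{p<..r} \<subseteq> {p<..q} \<union> {q<..r}" by auto
    then show ?thesis using that unfolding R_def by auto
  qed
  have "\<exists>f :: nat \<Rightarrow> real. inj_on f {1..j} \<and>
      (\<forall>p q. R p q \<longrightarrow> label d p \<le> j \<longrightarrow> label d q \<le> j \<longrightarrow> f (label d q) < f (label d p))"
    if "j \<le> n" for j
    using that
  proof (induction j)
    case 0
    have "\<not> label d p \<le> 0" if "R p q" for p q
      using that label_range[of p] by (simp add: R_def)
    then have "\<forall>p q. R p q \<longrightarrow> label d p \<le> 0 \<longrightarrow> label d q \<le> 0 \<longrightarrow> real (label d q) < real (label d p)"
      by blast
    then show ?case by (intro exI[of _ real]) simp
  next
    case (Suc j)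
    then obtain f :: "nat \<Rightarrow> real" where f: "inj_on f {1..j}"
      and fR: "\<And>p q. R p q \<Longrightarrow> label d p \<le> j \<Longrightarrow> label d q \<le> j \<Longrightarrow> f (label d q) < f (label d p)"
      by auto
    let ?i = "Suc j"
    have i: "?i \<in> {1..n}" using Suc.prems by simp
    \<comment> \<open>The values that the new label must exceed, and in \<open>H\<close> those it
      must stay below. Everything rests on \<open>L\<close> lying below \<open>H\<close>.\<close>
    define L where "L = {f (label d q) | p q. R p q \<and> label d p = ?i \<and> label d q \<le> j}"
    define H where "H = {f (label d p) | p q. R p q \<and> label d q = ?i \<and> label d p \<le> j}"
    have pos: "p = pU ?i \<or> p = pD ?i" if "p < 2 * n" "label d p = ?i" for p
      using pos_label[of p] that by (cases "d ! p") auto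
    \<comment> \<open>To the right of the new up-step, earlier labels can occur only at their
      down-steps.\<close>
    have Down_below: "d ! p = Down \<and> p = pD (label d p) \<and> label d p \<in> {1..n}"
      if "p < 2 * n" "label d p \<le> j" "pU ?i < p" for p
    proof -
      have "d ! p \<noteq> Up"
        using pos_le_iff[OF label_range[OF that(1)] i, of Up] pos_label[OF that(1)] that by fastforce
      then show ?thesis
        using pos_label[OF that(1)] label_range[OF that(1)] by (cases "d ! p") auto
    qed
    \<comment> \<open>Hence no lower bound comes from the second occurrence of the new label: all of
      \<open>L\<close> stems from the segment of \<open>pU ?i\<close>.\<close>
    have before_pD: "p < pD ?i" if "p < 2 * n" "label d p \<le> j" for p
    proof (cases "pU ?i < p")
      case True
      then show ?thesis
        using Down_below[OF that True] pos_less_pos_iff[of "label d p" ?i Down] i that by force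
    qed (use pU_less_pD[OF i] in simp)
    have LH: "l < h" if "l \<in> L" "h \<in> H" for l h
    proof -
      obtain p q where pq: "R p q" "label d p = ?i" "label d q \<le> j" "l = f (label d q)"
        using \<open>l \<in> L\<close> by (auto simp: L_def)
      obtain p' q' where pq': "R p' q'" "label d q' = ?i" "label d p' \<le> j" "h = f (label d p')"
        using \<open>h \<in> H\<close> by (auto simp: H_def)
      have bounds: "p < q" "q < 2 * n" "p' < q'" "q' < 2 * n"
        using pq pq' by (auto simp: R_def)
      have "p \<noteq> pD ?i"
        using before_pD[of q] pq bounds by auto
      then have p: "p = pU ?i"
        using pos[of p] pq bounds by auto
      from pos[of q'] pq' bounds consider "q' = p" | "q' = pD ?i"
        using p by auto
      then show ?thesis
      proof cases
        case 1
        then have "R p' q"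
          using R_trans pq pq' by blast
        then show ?thesis
          using fR pq pq' by blast
      next
        \<comment> \<open>The bounds come from different segments: \<open>q\<close> follows the new
          up-step, \<open>p'\<close> precedes the new down-step, and the cut \<open>a\<close> lies
          between them. The comparison goes through the other occurrence of the label
          \<open>t\<close> of \<open>p'\<close>.\<close>
        case 2
        have "A \<inter> {pU ?i<..pD ?i} \<noteq> {}"
          using A i unfolding stabs_def by blast
        then obtain a where a: "a \<in> A" "p < a" "a \<le> q'"
          using p 2 by auto
        have "a \<notin> {p<..q}" "a \<notin> {p'<..q'}"
          using a(1) pq(1) pq'(1) unfolding R_def by blast+
        then have ap': "a \<le> p'" and qa: "q < a"
          using a by auto
        define t where "t = label d p'"
        have q: "d ! q = Down"
          using Down_below[of q] pq p bounds by simp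
        have p': "p' = pD t" "t \<in> {1..n}" "t \<le> j"
          using Down_below[of p'] pq' bounds p a ap' by (auto simp: t_def)
        have pUt: "pU t < p"
          using pos_less_pos_iff[OF p'(2) i, of Up] p' p by simp
        \<comment> \<open>A cut \<open>a0\<close> here would lie at or before \<open>p\<close>. Then
          \<open>a0\<close> and \<open>a\<close> both lie in the interval of \<open>t\<close> and
          enclose the up-step \<open>p\<close> and the down-step \<open>q\<close>, so
          \<open>noUD\<close> would give a cut between \<open>p\<close> and
          \<open>q\<close>.\<close>
        have "A \<inter> {pU t<..q} = {}"
        proof (rule ccontr)
          assume "A \<inter> {pU t<..q} \<noteq> {}"
          then obtain a0 where a0: "a0 \<in> A" "pU t < a0" "a0 \<le> q" by auto
          then have "a0 \<notin> {p<..q}"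
            using pq(1) unfolding R_def by blast
          then have "a0 \<le> p"
            using a0 by simp
          then have "A \<inter> {p<..q} \<noteq> {}"
            using noUD[of t a0 a p q] a0 a qa ap' p' p q bounds pos_props(2)[OF i, of Up] by simp
          then show False using pq(1) by (simp add: R_def)
        qed
        then have "R (pU t) q"
          using bounds pUt by (simp add: R_def)
        then show ?thesis
          using fR[of "pU t" q] pos_props(3)[OF p'(2), of Up] p'(3) pq pq' by (simp add: t_def)
      qed
    qed
    have "finite L" "finite H"
      by (rule finite_subset[of _ "f ` {..j}"]; force simp: L_def H_def)+
    then obtain y where y: "y \<notin> f ` {1..j}" "\<And>l. l \<in> L \<Longrightarrow> l < y" "\<And>h. h \<in> H \<Longrightarrow> y < h"
      using separating_value[of L H "f ` {1..j}"] LH by auto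
    \<comment> \<open>The two occurrences of one label are always separated by a cut.\<close>
    have same: False if "R p q" "label d p = ?i" "label d q = ?i" for p q
    proof -
      have "p = pU ?i" "q = pD ?i"
        using pos[of p] pos[of q] pU_less_pD[OF i] that by (auto simp: R_def)
      then show False
        using A that i by (auto simp: R_def stabs_def)
    qed
    let ?g = "f(?i := y)"
    have "{1..?i} = insert ?i {1..j}" by auto
    moreover have "?g ` {1..j} = f ` {1..j}" by (intro image_cong) auto
    ultimately have "inj_on ?g {1..?i}"
      using inj_on_fun_updI[OF f y(1), of ?i] y(1) by (simp add: inj_on_insert)
    moreover have "?g (label d q) < ?g (label d p)"
      if "R p q" "label d p \<le> ?i" "label d q \<le> ?i" for p q
    proof (cases "label d p = ?i")
      case True
      then have "label d q \<le> j"
        using same that le_Suc_eq by blast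
      moreover from this have "f (label d q) \<in> L"
        using that True by (auto simp: L_def)
      ultimately show ?thesis
        using y(2) True by auto
    next
      case p: False
      show ?thesis
      proof (cases "label d q = ?i")
        case True
        then have "f (label d p) \<in> H"
          using that p by (force simp: H_def)
        then show ?thesis
          using y(3) True p by auto
      next
        case False
        then show ?thesis
          using fR that p by auto
      qed
    qed
    ultimately show ?case by blast
  qed
  from this[of n] obtain f :: "nat \<Rightarrow> real" where f: "inj_on f {1..n}"
    and fR: "\<And>p q. R p q \<Longrightarrow> label d p \<le> n \<Longrightarrow> label d q \<le> n \<Longrightarrow> f (label d q) < f (label d p)"
    by auto
  obtain \<sigma> where \<sigma>: "\<sigma> permutes {1..n}"
    "\<And>i j. i \<in> {1..n} \<Longrightarrow> j \<in> {1..n} \<Longrightarrow> f i < f j \<Longrightarrow> \<sigma> i < \<sigma> j"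
    using permutation_of_injection[OF f] by blast
  have "nondes \<sigma> \<subseteq> A"
  proof
    fix x assume x: "x \<in> nondes \<sigma>"
    then have r: "label d (x - 1) \<in> {1..n}" "label d x \<in> {1..n}"
      using label_range by (auto simp: nondes_iff)
    show "x \<in> A"
    proof (rule ccontr)
      assume "x \<notin> A"
      moreover have "{x - 1<..x} = {x}" "x - 1 < x" "x < 2 * n"
        using x by (auto simp: nondes_iff)
      ultimately have "R (x - 1) x"
        by (simp add: R_def)
      then have "\<sigma> (label d x) < \<sigma> (label d (x - 1))"
        using \<sigma>(2) fR r by simp
      then show False
        using x by (simp add: nondes_iff)
    qed
  qed
  then show ?thesis
    using \<sigma>(1) that by blast
qed

section \<open>The bounce path\<close>

text \<open>A vertex of \<open>d\<close> at height \<open>k\<close> and abscissa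
  \<open>2 * (s - 1) + k\<close> has exactly \<open>s - 1\<close> down-steps before it. If a
  down-step follows, it is the \<open>s\<close>-th, so the bounce peak lies at
  \<open>pD s\<close>.\<close>

lemma bounce_rise_eq:
  assumes s: "s \<in> {1..n}"
  shows "bounce_rise d (2 * (s - 1)) = u (pD s) - (s - 1)"
  unfolding bounce_rise_def
proof (rule Least_equality)
  have v: "v (pD s) = s - 1" "pD s < 2 * n" "d ! pD s = Down"
    using pos_props[OF s] by auto
  then have uv: "u (pD s) + (s - 1) = pD s" "s - 1 \<le> u (pD s)"
    using u_v[of "pD s"] v_le_u[of "pD s"] by auto
  then have e: "2 * (s - 1) + (u (pD s) - (s - 1)) = pD s" by simp
  show "2 * (s - 1) + (u (pD s) - (s - 1)) < length d \<and>
      height d (2 * (s - 1) + (u (pD s) - (s - 1))) = int (u (pD s) - (s - 1)) \<and>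
      d ! (2 * (s - 1) + (u (pD s) - (s - 1))) = Down"
    unfolding e using v uv by (simp add: length_d height_eq_cnt)
  fix k assume k: "2 * (s - 1) + k < length d \<and> height d (2 * (s - 1) + k) = int k \<and>
      d ! (2 * (s - 1) + k) = Down"
  let ?x = "2 * (s - 1) + k"
  have "v ?x = s - 1"
    using u_v[of ?x] k by (simp add: length_d height_eq_cnt)
  then have "label d ?x = s"
    using k s by (simp add: label_def cnt_Suc)
  then have "pD s = ?x"
    using pos_label[of ?x Down] k by (simp add: length_d)
  then show "u (pD s) - (s - 1) \<le> k"
    using e by simp
qed

text \<open>The bounce path runs the greedy algorithm for interval stabbing: take the interval that
  ends first, cut at its right end \<open>pD s\<close>, and continue with the first interval
  beginning after that cut. Half-openness makes \<open>pD i \<le> pU j\<close> express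
  disjointness.\<close>

lemma bounce_intervals_from:
  assumes "1 \<le> s" "s \<le> Suc n"
  shows "\<exists>S \<subseteq> {s..n}. card S = pk (bounce_from d (2 * (s - 1))) \<and>
    (\<forall>i\<in>S. \<forall>j\<in>S. i < j \<longrightarrow> pD i \<le> pU j) \<and>
    (\<forall>i\<in>{s..n}. \<exists>j\<in>S. pU i < pD j \<and> pD j \<le> pD i)"
  using assms
proof (induction "Suc n - s" arbitrary: s rule: less_induct)
  case less
  show ?case
  proof (cases "s = Suc n")
    case True
    then have "bounce_from d (2 * (s - 1)) = []"
      by (simp add: bounce_from.simps length_d)
    then show ?thesis
      using True by (intro exI[of _ "{}"]) (simp add: pk_eq_card peak_positions_def)
  next
    case False
    then have s: "s \<in> {1..n}" using less.prems by simp
    \<comment> \<open>The first label whose up-step comes after \<open>pD s\<close>; the bounce path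
      returns to the axis at \<open>2 * (s' - 1)\<close>.\<close>
    define s' where "s' = Suc (u (pD s))"
    have u: "s \<le> u (pD s)"
      using pos_less_iff[OF s, of Up "pD s"] pU_less_pD[OF s] by simp
    have s': "s < s'" "s' \<le> Suc n"
      using u cnt_le[of Up "pD s"] by (auto simp: s'_def)
    obtain S where S: "S \<subseteq> {s'..n}" "card S = pk (bounce_from d (2 * (s' - 1)))"
      "\<forall>i\<in>S. \<forall>j\<in>S. i < j \<longrightarrow> pD i \<le> pU j"
      "\<forall>i\<in>{s'..n}. \<exists>j\<in>S. pU i < pD j \<and> pD j \<le> pD i"
      using less.hyps[OF diff_less_mono2[of s s' "Suc n"]] s' s by auto
    have far: "pD s \<le> pU j" if "j \<in> {s'..n}" for j
      using pos_less_iff[of j Up "pD s"] that s' s by (auto simp: s'_def)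
    have "2 * (s - 1) + 2 * (u (pD s) - (s - 1)) = 2 * (s' - 1)"
      using u by (simp add: s'_def)
    then have "pk (bounce_from d (2 * (s - 1))) = Suc (card S)"
      using s u S(2) bounce_rise_eq[OF s] diff_less[of 1 s] by (subst bounce_from.simps) (auto simp: length_d pk_bounce)
    moreover have "finite S" "s \<notin> S"
      using S(1) s' by (auto intro: finite_subset)
    moreover have "\<exists>j\<in>insert s S. pU i < pD j \<and> pD j \<le> pD i" if i: "i \<in> {s..n}" for i
    proof (cases "i < s'")
      case True
      then have "pU i < pD s"
        using pos_less_iff[of i Up "pD s"] i s by (auto simp: s'_def)
      moreover have "pD s \<le> pD i"
        using pos_le_iff[of s i Down] i s by auto
      ultimately show ?thesis by blast
    next
      case False
      then show ?thesis using S(4) i by auto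
    qed
    moreover have "insert s S \<subseteq> {s..n}"
      using S(1) s s' by fastforce
    moreover have "\<forall>i\<in>insert s S. \<forall>j\<in>insert s S. i < j \<longrightarrow> pD i \<le> pU j"
      using S(1,3) far s' by fastforce
    ultimately show ?thesis
      by (intro exI[of _ "insert s S"]) simp
  qed
qed

lemma bounce_intervals:
  obtains S where "S \<subseteq> {1..n}" "card S = bpk d"
    "\<And>i j. i \<in> S \<Longrightarrow> j \<in> S \<Longrightarrow> i < j \<Longrightarrow> pD i \<le> pU j"
    "\<And>i. i \<in> {1..n} \<Longrightarrow> \<exists>j\<in>S. pU i < pD j \<and> pD j \<le> pD i"
  using bounce_intervals_from[of 1] that unfolding bpk_def bounce_path_def by auto

text \<open>Pairwise disjoint intervals need distinct cuts, one for each element of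
  \<open>S\<close>. In case of equality these cuts exhaust \<open>A\<close>, so each is alone in its
  chosen interval.\<close>

lemma stabs_card:
  assumes A: "stabs A"
  shows bpk_le_card: "bpk d \<le> card A"
    and critical_interval: "card A = bpk d \<Longrightarrow> a \<in> A \<Longrightarrow> \<exists>i\<in>{1..n}. A \<inter> {pU i<..pD i} = {a}"
proof -
  obtain S where S: "S \<subseteq> {1..n}" "card S = bpk d"
    and disj: "\<And>i j. i \<in> S \<Longrightarrow> j \<in> S \<Longrightarrow> i < j \<Longrightarrow> pD i \<le> pU j"
    using bounce_intervals by metis
  have "\<forall>i\<in>S. \<exists>a. a \<in> A \<inter> {pU i<..pD i}"
    using A S(1) unfolding stabs_def by blast
  then obtain c where c: "\<And>i. i \<in> S \<Longrightarrow> c i \<in> A \<inter> {pU i<..pD i}"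
    by metis
  have same: "i = j" if "i \<in> S" "j \<in> S" "x \<in> {pU i<..pD i}" "x \<in> {pU j<..pD j}" for i j x
    using disj[of i j] disj[of j i] that by (cases i j rule: linorder_cases) auto
  have inj: "inj_on c S"
    using same c by (intro inj_onI) (metis IntD2)
  have sub: "c ` S \<subseteq> A" using c by auto
  show "bpk d \<le> card A"
    using card_inj_on_le[OF inj sub] finite_stabs[OF A] S(2) by simp
  assume "card A = bpk d" "a \<in> A"
  then have "c ` S = A"
    using card_image[OF inj] S(2) finite_stabs[OF A] sub by (intro card_subset_eq) auto
  then obtain i where i: "i \<in> S" "a = c i" using \<open>a \<in> A\<close> by auto
  have "x = a" if x: "x \<in> A \<inter> {pU i<..pD i}" for x
  proof -
    obtain j where "j \<in> S" "x = c j" using x \<open>c ` S = A\<close> by auto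
    then show ?thesis using same[of i j x] c i x by auto
  qed
  then have "A \<inter> {pU i<..pD i} = {a}" using c i by auto
  then show "\<exists>i\<in>{1..n}. A \<inter> {pU i<..pD i} = {a}" using i S(1) by auto
qed

lemma M_iff: "\<sigma> \<in> M n d \<longleftrightarrow> \<sigma> permutes {1..n} \<and> card (nondes \<sigma>) = bpk d"
proof -
  obtain S where S: "S \<subseteq> {1..n}" "card S = bpk d"
    and disj: "\<And>i j. i \<in> S \<Longrightarrow> j \<in> S \<Longrightarrow> i < j \<Longrightarrow> pD i \<le> pU j"
    and stab: "\<And>i. i \<in> {1..n} \<Longrightarrow> \<exists>j\<in>S. pU i < pD j \<and> pD j \<le> pD i"
    using bounce_intervals by metis
  have "stabs (pD ` S)"
    unfolding stabs_def
  proof (intro conjI ballI)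
    show "pD ` S \<subseteq> {1..<2 * n}"
      using S(1) pU_less_pD pos_props(1) by (force simp: Suc_le_eq)
  qed (use stab in force)
  \<comment> \<open>The assumptions are contradictory: no interval contains two greedy cuts
    \<open>pD i < pD j\<close>, since \<open>pU t < pD i \<le> pU j\<close> gives
    \<open>t < j\<close>, whereas \<open>pD j \<le> pD t\<close> gives
    \<open>j \<le> t\<close>.\<close>
  moreover have "pD ` S \<inter> {p<..q} \<noteq> {}"
    if asm: "t \<in> {1..n}" "a \<in> pD ` S" "a' \<in> pD ` S" "pU t < a" "a \<le> p" "p < q" "q < a'" "a' \<le> pD t"
    for t a a' p q
  proof -
    obtain i j where ij: "i \<in> S" "j \<in> S" "a = pD i" "a' = pD j" using asm by auto
    then have r: "i \<in> {1..n}" "j \<in> {1..n}" using S(1) by auto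
    have "i < j" using pos_less_pos_iff[OF r, of Down] ij asm by simp
    then have "t < j" using disj[of i j] pos_less_pos_iff[OF asm(1) r(2), of Up] ij asm by simp
    then show ?thesis using pos_le_iff[OF r(2) asm(1), of Down] ij asm by simp
  qed
  ultimately obtain \<sigma>0 where \<sigma>0: "\<sigma>0 permutes {1..n}" "nondes \<sigma>0 \<subseteq> pD ` S"
    using nondes_realizable[of "pD ` S"] by metis
  have "finite S" using S(1) by (rule finite_subset) simp
  then have "card (nondes \<sigma>0) \<le> bpk d"
    using card_mono[OF _ \<sigma>0(2)] card_image_le[of S pD] S(2) by simp
  then have c0: "card (nondes \<sigma>0) = bpk d"
    using bpk_le_card[OF stabs_nondes, of \<sigma>0] by simp
  have "max_des n d = 2 * n - 1 - bpk d"
    unfolding max_des_def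
  proof (rule Max_eqI)
    have "{des d \<sigma> | \<sigma>. \<sigma> permutes {1..n}} = des d ` {\<sigma>. \<sigma> permutes {1..n}}" by auto
    then show "finite {des d \<sigma> | \<sigma>. \<sigma> permutes {1..n}}"
      by (simp add: finite_permutations)
    show "2 * n - 1 - bpk d \<in> {des d \<sigma> | \<sigma>. \<sigma> permutes {1..n}}"
      unfolding mem_Collect_eq c0[symmetric] des_eq_card_nondes[symmetric] using \<sigma>0(1) by blast
    show "y \<le> 2 * n - 1 - bpk d" if "y \<in> {des d \<sigma> | \<sigma>. \<sigma> permutes {1..n}}" for y
      using that bpk_le_card[OF stabs_nondes] by (auto simp: des_eq_card_nondes diff_le_mono2)
  qed
  then show ?thesis
    using card_nondes_le[of \<sigma>] card_nondes_le[of \<sigma>0] c0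
    by (auto simp: M_def des_eq_card_nondes)
qed


section \<open>Sorting the segments between cuts\<close>

text \<open>The inserted 0, and \<open>2 * n\<close> in \<open>seg_end\<close>, let the ends of the
  path act as cuts. A segment consists of the indices from its start up to, but excluding, its end,
  so a cut starts its own segment.\<close>

definition seg_start :: "nat set \<Rightarrow> nat \<Rightarrow> nat" where
  "seg_start A p = Max (insert 0 {a \<in> A. a \<le> p})"

definition seg_end :: "nat set \<Rightarrow> nat \<Rightarrow> nat" where
  "seg_end A p = Min (insert (2 * n) {a \<in> A. p < a})"

lemma seg_props:
  assumes "A \<subseteq> {1..<2 * n}"
  shows "seg_start A p \<in> insert 0 A" "seg_start A p \<le> p" "seg_end A p \<in> insert (2 * n) A"
    "p < 2 * n \<Longrightarrow> p < seg_end A p" "seg_end A p \<le> 2 * n"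
    "A \<inter> {seg_start A p<..<seg_end A p} = {}" "p \<le> 2 * n \<Longrightarrow> p \<le> seg_end A p"
proof -
  have fin: "finite A" using assms by (rule finite_subset) simp
  have 1: "seg_start A p \<in> insert 0 {a \<in> A. a \<le> p}"
    unfolding seg_start_def using fin by (intro Max_in) auto
  have 2: "seg_end A p \<in> insert (2 * n) {a \<in> A. p < a}"
    unfolding seg_end_def using fin by (intro Min_in) auto
  show "seg_start A p \<in> insert 0 A" "seg_start A p \<le> p" "seg_end A p \<in> insert (2 * n) A"
    "p < 2 * n \<Longrightarrow> p < seg_end A p" "seg_end A p \<le> 2 * n" "p \<le> 2 * n \<Longrightarrow> p \<le> seg_end A p"
    using 1 2 assms by auto
  have "a \<le> seg_start A p" if "a \<in> A" "a \<le> p" for a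
    unfolding seg_start_def using fin that by (intro Max_ge) auto
  moreover have "seg_end A p \<le> a" if "a \<in> A" "p < a" for a
    unfolding seg_end_def using fin that by (intro Min_le) auto
  ultimately show "A \<inter> {seg_start A p<..<seg_end A p} = {}"
    by (auto simp: disjoint_iff) (metis not_le)
qed

lemma seg_Suc:
  assumes "Suc p \<notin> A"
  shows "seg_start A (Suc p) = seg_start A p" "seg_end A (Suc p) = seg_end A p"
proof -
  have "{a \<in> A. a \<le> Suc p} = {a \<in> A. a \<le> p}" "{a \<in> A. Suc p < a} = {a \<in> A. p < a}"
    using assms by (auto simp: le_Suc_eq) (metis Suc_lessI)
  then show "seg_start A (Suc p) = seg_start A p" "seg_end A (Suc p) = seg_end A p"
    by (simp_all add: seg_start_def seg_end_def)
qed

lemma seg_cut: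
  assumes "A \<subseteq> {1..<2 * n}" "a \<in> A"
  shows "seg_start A a = a" "a = Suc p \<Longrightarrow> seg_end A p = a"
proof -
  have fin: "finite A" using assms(1) by (rule finite_subset) simp
  show "seg_start A a = a"
    unfolding seg_start_def using fin assms by (intro Max_eqI) auto
  show "seg_end A p = a" if "a = Suc p"
    unfolding seg_end_def using fin assms that by (intro Min_eqI) auto
qed

text \<open>Otherwise the label \<open>v e\<close>, with \<open>e\<close> the end of the segment,
  would have both its steps inside the segment and its interval would contain no cut.\<close>

lemma stabs_segment:
  assumes "stabs A"
  shows "v (seg_end A p) \<le> u (seg_start A p)"
proof (rule ccontr)
  let ?c = "seg_start A p" and ?e = "seg_end A p"
  assume n: "\<not> v ?e \<le> u ?c"
  define i where "i = v ?e"
  have i: "u ?c < i" "i \<in> {1..n}"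
    using n cnt_le[of Down ?e] by (auto simp: i_def)
  then have "\<not> pU i < ?c" "pD i < ?e"
    using pos_less_iff[OF i(2), of Up ?c] pos_less_iff[OF i(2), of Down ?e] by (auto simp: i_def)
  moreover obtain a where "a \<in> A" "pU i < a" "a \<le> pD i"
    using assms(1) i(2) unfolding stabs_def by fastforce
  moreover have "A \<inter> {?c<..<?e} = {}"
    using seg_props(6) assms by (auto simp: stabs_def)
  ultimately show False by (auto simp: disjoint_iff)
qed

text \<open>The path through the vertices of \<open>d\<close> above \<open>A\<close> that takes all down-steps of a segment
  before its up-steps.\<close>

definition sorted_path :: "nat set \<Rightarrow> path" where
  "sorted_path A = map (\<lambda>p. if p + v (seg_start A p) < seg_start A p + v (seg_end A p) then Down else Up)
     [0..<2 * n]"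

lemma length_sorted_path [simp]: "length (sorted_path A) = 2 * n"
  by (simp add: sorted_path_def)

lemma sorted_path_nth:
  "p < 2 * n \<Longrightarrow> sorted_path A ! p =
    (if p + v (seg_start A p) < seg_start A p + v (seg_end A p) then Down else Up)"
  by (simp add: sorted_path_def)

lemma v_Lipschitz: "x \<le> y \<Longrightarrow> y \<le> 2 * n \<Longrightarrow> v y + x \<le> v x + y"
  using cnt_Lipschitz[of x y d Down] by (simp add: length_d)

text \<open>With start \<open>c\<close> and end \<open>e\<close>, the test in
  \<open>sorted_path\<close> reads \<open>p - c < v e - v c\<close>, written without subtraction. So
  the count rises by one per step from \<open>v c\<close> until it reaches \<open>v e\<close>, and
  then stays.\<close>

lemma cnt_sorted_path:
  assumes A: "A \<subseteq> {1..<2 * n}" and "x \<le> 2 * n"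
  shows "cnt (sorted_path A) Down x =
    min (v (seg_end A x)) (v (seg_start A x) + (x - seg_start A x))"
  using assms(2)
proof (induction x)
  case 0
  have "seg_start A 0 = 0" using seg_props(2)[OF A, of 0] by simp
  then show ?case by simp
next
  case (Suc x)
  let ?c = "seg_start A x" and ?e = "seg_end A x"
  have x: "x < 2 * n" using Suc.prems by simp
  note p = seg_props[OF A, of x]
  have IH: "cnt (sorted_path A) Down (Suc x) = min (v ?e) (v ?c + (x - ?c)) +
      (if x + v ?c < ?c + v ?e then 1 else 0)"
    using Suc x by (auto simp: cnt_Suc sorted_path_nth)
  show ?case
  proof (cases "Suc x \<in> A")
    case False
    then show ?thesis
      unfolding IH seg_Suc[OF False] using p(2) by auto
  next
    case True
    have e: "?e = Suc x" using seg_cut(2)[OF A True] by simp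
    have "v (Suc x) \<le> v (seg_end A (Suc x))"
      using seg_props(3,4)[OF A, of "Suc x"] True A by (intro cnt_mono) auto
    then show ?thesis
      unfolding IH e seg_cut(1)[OF A True] using v_Lipschitz[of ?c "Suc x"] p(2) x by auto
  qed
qed

lemma cnt_sorted_path_cut:
  assumes "A \<subseteq> {1..<2 * n}" "a \<in> A"
  shows "cnt (sorted_path A) Down a = v a"
proof -
  have "a < 2 * n" using assms by auto
  then have "v a \<le> v (seg_end A a)"
    using seg_props(4)[OF assms(1), of a] by (intro cnt_mono) simp
  then show ?thesis
    using cnt_sorted_path[OF assms(1), of a] seg_cut(1)[OF assms] \<open>a < 2 * n\<close> by simp
qed

lemma height_from_Down: "length b = 2 * n \<Longrightarrow> x \<le> 2 * n \<Longrightarrow> height b x = int x - 2 * int (cnt b Down x)"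
  using cnt_Up_Down[of x b] by (simp add: height_eq_cnt)

lemma under_sorted_path:
  assumes A: "A \<subseteq> {1..<2 * n}"
  shows "under (sorted_path A) d"
proof -
  have "v x \<le> cnt (sorted_path A) Down x" if x: "x \<le> 2 * n" for x
  proof -
    have "v x \<le> v (seg_end A x)"
      using seg_props(7)[OF A x] by (rule cnt_mono)
    then show ?thesis
      unfolding cnt_sorted_path[OF A x]
      using v_Lipschitz[of "seg_start A x" x] seg_props(2)[OF A, of x] x by simp
  qed
  then show ?thesis
    by (simp add: under_def length_d height_from_Down)
qed

text \<open>The two arguments of the minimum in \<open>cnt_sorted_path\<close> are at most
  \<open>u c\<close> and \<open>v c + (x - c)\<close>, which add up to \<open>x\<close>; hence at
  most half of the first \<open>x\<close> steps are down-steps.\<close>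

lemma dyck_sorted_path:
  assumes A: "stabs A"
  shows "dyck_path n (sorted_path A)"
proof -
  have sub: "A \<subseteq> {1..<2 * n}" using A by (simp add: stabs_def)
  have "2 * cnt (sorted_path A) Down x \<le> x" if x: "x < 2 * n" for x
    using cnt_sorted_path[OF sub, of x] stabs_segment[OF A, of x] u_v[of "seg_start A x"]
      seg_props(2)[OF sub, of x] x by auto
  moreover have "cnt (sorted_path A) Down (2 * n) = n"
  proof -
    have "seg_end A (2 * n) = 2 * n"
      using seg_props(5,7)[OF sub, of "2 * n"] by simp
    then show ?thesis
      using cnt_sorted_path[OF sub, of "2 * n"] seg_props(2)[OF sub, of "2 * n"]
        v_Lipschitz[of "seg_start A (2 * n)" "2 * n"] by simp
  qed
  ultimately show ?thesis
    by (auto simp: dyck_path_def height_from_Down order.order_iff_strict[of _ "2 * n"]) force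
qed

text \<open>Sorted segments have no inner peaks. If the cut \<open>a\<close> is alone in the
  interval of \<open>i\<close>, then the \<open>i\<close>-th up-step lies in the segment ending at
  \<open>a\<close> and the \<open>i\<close>-th down-step in the one starting there, so sorting puts
  a peak at \<open>a\<close>.\<close>

lemma peak_positions_sorted_path:
  assumes A: "A \<subseteq> {1..<2 * n}"
    and critical: "\<And>a. a \<in> A \<Longrightarrow> \<exists>i\<in>{1..n}. A \<inter> {pU i<..pD i} = {a}"
  shows "peak_positions (sorted_path A) = A"
proof (intro set_eqI iffI)
  fix x assume "x \<in> peak_positions (sorted_path A)"
  then obtain i where i: "x = Suc i" "Suc i < 2 * n" "sorted_path A ! i = Up" "sorted_path A ! Suc i = Down"
    by (auto simp: peak_positions_def)
  then show "x \<in> A"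
    using seg_Suc[of i A] by (force simp: sorted_path_nth split: if_splits)
next
  fix a assume a: "a \<in> A"
  then obtain p where p: "a = Suc p" "Suc p < 2 * n" using A by (cases a) auto
  obtain i where i: "i \<in> {1..n}" "A \<inter> {pU i<..pD i} = {a}" using critical[OF a] by auto
  then have ai: "pU i < a" "a \<le> pD i" by auto
  let ?c = "seg_start A p" and ?e = "seg_end A a"
  have "?c \<le> pU i"
  proof (rule ccontr)
    assume "\<not> ?thesis"
    then have "?c \<in> A \<inter> {pU i<..pD i}"
      using seg_props(1,2)[OF A, of p] p ai by auto
    then show False using i(2) seg_props(2)[OF A, of p] p by auto
  qed
  then have "u ?c < i" using pos_less_iff[OF i(1), of Up ?c] by simp
  moreover have "i \<le> u a" using pos_less_iff[OF i(1), of Up a] ai by simp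
  ultimately have "\<not> p + v ?c < ?c + v a"
    using u_v[of ?c] u_v[of a] p seg_props(2)[OF A, of p] by simp
  then have "sorted_path A ! p = Up"
    using seg_cut(2)[OF A a p(1)] p by (simp add: sorted_path_nth)
  moreover have "sorted_path A ! a = Down"
  proof -
    have "pD i < ?e"
    proof (rule ccontr)
      assume "\<not> ?thesis"
      then have "?e \<in> A \<inter> {pU i<..pD i}"
        using seg_props(3,4)[OF A, of a] p ai pos_props(1)[OF i(1), of Down] by auto
      then show False using i(2) seg_props(4)[OF A, of a] p by auto
    qed
    then have "i \<le> v ?e" using pos_less_iff[OF i(1)] by simp
    moreover have "v a < i" using pos_less_iff[OF i(1), of Down a] ai by simp
    ultimately show ?thesis
      using seg_cut(1)[OF A a] p by (simp add: sorted_path_nth)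
  qed
  ultimately show "a \<in> peak_positions (sorted_path A)"
    using p by (auto simp: peak_positions_def)
qed

text \<open>If the segment from \<open>c\<close> to \<open>e\<close> has an up-step before a down-step but \<open>v e < u c\<close>, then the
  labels \<open>v e\<close>, \<open>u c\<close>, \<open>u c + 1\<close> form a cycle of forced descents running through this segment and
  its two neighbours.\<close>

lemma segment_sorted_or_touching:
  assumes card: "card (nondes \<sigma>) = bpk d"
    and c: "c \<in> insert 0 (nondes \<sigma>)" and e: "e \<in> insert (2 * n) (nondes \<sigma>)"
    and seg: "nondes \<sigma> \<inter> {c<..<e} = {}" and pq: "c \<le> p" "p < q" "q < e"
    and UD: "d ! p = Up" "d ! q = Down" and le: "v e \<le> u c"
  shows "u c = v e"
proof (rule ccontr)
  assume "u c \<noteq> v e"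
  then have less: "v e < u c" using le by simp
  have sub: "nondes \<sigma> \<subseteq> {1..<2 * n}" by (auto simp: nondes_def)
  have e2n: "e \<le> 2 * n" using e sub by auto
  \<comment> \<open>Strictness excludes the ends of the path, where \<open>u c = 0\<close> or
    \<open>v e = n\<close>. So \<open>c\<close> and \<open>e\<close> are true cuts, each alone in
    some interval.\<close>
  have "c \<noteq> 0" using less by (cases c) auto
  then have cA: "c \<in> nondes \<sigma>" using c by simp
  have "e \<noteq> 2 * n" using less cnt_le[of Up c] by auto
  then have eA: "e \<in> nondes \<sigma>" using e by simp
  \<comment> \<open>\<open>w\<close> labels the last down-step before \<open>e\<close>,
    \<open>t\<close> the last up-step before \<open>c\<close>, and \<open>Suc t\<close> the first
    up-step from \<open>c\<close> on.\<close>
  define w where "w = v e"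
  define t where "t = u c"
  obtain s where s: "s \<in> {1..n}" "nondes \<sigma> \<inter> {pU s<..pD s} = {c}"
    using critical_interval[OF stabs_nondes card cA] by auto
  obtain s' where s': "s' \<in> {1..n}" "nondes \<sigma> \<inter> {pU s'<..pD s'} = {e}"
    using critical_interval[OF stabs_nondes card eA] by auto
  have cs: "pU s < c" "c \<le> pD s" and es': "pU s' < e" "e \<le> pD s'" using s s' by auto
  have ce: "c < e" using pq by simp
  have "e \<notin> {pU s<..pD s}" "c \<notin> {pU s'<..pD s'}"
    using s(2) s'(2) eA cA ce by auto
  then have "pD s < e" "c \<le> pU s'"
    using cs es' ce by auto
  have sw: "s \<le> w" using \<open>pD s < e\<close> pos_less_iff[OF s(1), of Down e] by (simp add: w_def)
  have ts': "t < s'" using \<open>c \<le> pU s'\<close> pos_less_iff[OF s'(1), of Up c] by (simp add: t_def)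
  have wt: "w < t" using less by (simp add: w_def t_def)
  have r: "w \<in> {1..n}" "t \<in> {1..n}" "Suc t \<in> {1..n}"
    using s(1) s'(1) sw wt ts' by auto
  \<comment> \<open>The interval of \<open>s\<close> has \<open>c\<close> as its only cut, so the
    up-steps of \<open>w\<close> and \<open>t\<close> lie in the segment ending at \<open>c\<close>.
    Symmetrically, \<open>s'\<close> puts the down-steps of \<open>t\<close> and
    \<open>Suc t\<close> into the segment starting at \<open>e\<close>.\<close>
  have "\<sigma> t < \<sigma> w"
  proof -
    have "pU s \<le> pU w" "pU w < pU t"
      using pos_le_iff[OF s(1) r(1), of Up] pos_less_pos_iff[OF r(1,2), of Up] sw wt by auto
    moreover have "pU t < c" using pos_less_iff[OF r(2), of Up c] by (simp add: t_def)
    ultimately have "nondes \<sigma> \<inter> {pU w<..pU t} \<subseteq> nondes \<sigma> \<inter> {pU s<..pD s} - {c}"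
      using cs by auto
    then have "nondes \<sigma> \<inter> {pU w<..pU t} = {}" using s(2) by auto
    then show ?thesis
      using decreasing_on_segment[OF \<open>pU w < pU t\<close>] pos_props[OF r(1), of Up] pos_props[OF r(2), of Up] by simp
  qed
  moreover have "\<sigma> (Suc t) < \<sigma> t"
  proof -
    have "pD t < pD (Suc t)" "pD (Suc t) \<le> pD s'"
      using pos_less_pos_iff[OF r(2,3), of Down] pos_le_iff[OF r(3) s'(1), of Down] ts' by auto
    moreover have "e \<le> pD t" using pos_less_iff[OF r(2), of Down e] wt by (simp add: w_def)
    ultimately have "nondes \<sigma> \<inter> {pD t<..pD (Suc t)} \<subseteq> nondes \<sigma> \<inter> {pU s'<..pD s'} - {e}"
      using es' by auto
    then have "nondes \<sigma> \<inter> {pD t<..pD (Suc t)} = {}" using s'(2) by auto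
    then show ?thesis
      using decreasing_on_segment[OF \<open>pD t < pD (Suc t)\<close>] pos_props[OF r(2), of Down] pos_props[OF r(3), of Down] by simp
  qed
  \<comment> \<open>The cycle closes inside the segment, where
    \<open>pU (Suc t) \<le> p < q \<le> pD w\<close>.\<close>
  moreover have "\<sigma> w < \<sigma> (Suc t)"
  proof -
    have p: "p < 2 * n" "q < 2 * n" using pq e2n by auto
    have "t < label d p"
      using cnt_mono[OF pq(1), of d Up] UD(1) p by (simp add: label_def cnt_Suc length_d t_def)
    then have "pU (Suc t) \<le> p"
      using pos_le_iff[OF r(3) label_range[OF p(1)], of Up] pos_label[OF p(1) UD(1)] by simp
    moreover have "label d q \<le> w"
      using cnt_mono[of "Suc q" e d Down] UD(2) pq by (simp add: label_def w_def)
    then have "q \<le> pD w"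
      using pos_le_iff[OF label_range[OF p(2)] r(1), of Down] pos_label[OF p(2) UD(2)] by simp
    moreover have "c \<le> pU (Suc t)" using pos_less_iff[OF r(3), of Up c] by (auto simp: t_def)
    moreover have "pD w < e" using pos_less_iff[OF r(1), of Down e] by (simp add: w_def)
    ultimately have "pU (Suc t) < pD w" "nondes \<sigma> \<inter> {pU (Suc t)<..pD w} \<subseteq> nondes \<sigma> \<inter> {c<..<e}"
      using pq by auto
    then show ?thesis
      using decreasing_on_segment[of "pU (Suc t)" "pD w" \<sigma>] seg pos_props[OF r(3), of Up] pos_props[OF r(1), of Down] by auto
  qed
  ultimately show False by simp
qed

text \<open>The valley has height \<open>u c - v e\<close>. If this is not 0, then \<open>d\<close>
  has no up-step before a down-step in the segment, so it is sorted there already and has the same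
  valley.\<close>

lemma valleys_sorted_path:
  assumes card: "card (nondes \<sigma>) = bpk d" and z: "z \<in> valleys (sorted_path (nondes \<sigma>))"
  shows "z \<in> valleys d \<or> snd z = 0"
proof -
  let ?A = "nondes \<sigma>"
  let ?b = "sorted_path ?A"
  have A: "?A \<subseteq> {1..<2 * n}" by (auto simp: nondes_def)
  obtain i where i: "z = (Suc i, height ?b (Suc i))" "Suc i < 2 * n" "?b ! i = Down" "?b ! Suc i = Up"
    using z by (auto simp: valleys_def)
  define c e where "c = seg_start ?A i" and "e = seg_end ?A i"
  have "Suc i \<notin> peak_positions ?b"
    using i by (auto simp: peak_positions_def)
  then have notA: "Suc i \<notin> ?A"
    using peak_positions_sorted_path[OF A] critical_interval[OF stabs_nondes card] by blast
  note seg = seg_props[OF A, of i, folded c_def e_def]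
  have ie: "Suc i < e"
  proof -
    have "e \<noteq> Suc i" using seg(3) notA i(2) by auto
    then show ?thesis using seg(4) i(2) by simp
  qed
  have dn: "i + v c < c + v e" and up: "c + v e \<le> Suc i + v c"
    using i seg_Suc[OF notA] by (auto simp: sorted_path_nth c_def e_def split: if_splits)
  have cb: "cnt ?b Down (Suc i) = v e"
    using cnt_sorted_path[OF A, of "Suc i"] seg_Suc[OF notA] i(2) dn up seg(2) by (simp add: c_def e_def)
  have h: "height ?b (Suc i) = int (u c) - int (v e)"
    using height_from_Down[of ?b "Suc i"] cb i(2) dn up u_v[of c] seg(2) by simp
  show ?thesis
  proof (cases "u c = v e")
    case True
    then show ?thesis using i h by simp
  next
    case False
    have noUD: "\<not> (d ! p = Up \<and> d ! q = Down)" if "c \<le> p" "p < q" "q < e" for p q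
      using segment_sorted_or_touching[OF card seg(1,3,6) that] False
        stabs_segment[OF stabs_nondes, of \<sigma> i] i(2) by (auto simp: c_def e_def)
    \<comment> \<open>An up-step at \<open>i\<close> would squeeze all \<open>v e - v c\<close>
      down-steps of the segment into fewer than that many places.\<close>
    have "d ! i = Down"
    proof (rule ccontr)
      assume "d ! i \<noteq> Down"
      then have "d ! i = Up" by (cases "d ! i") auto
      then have "v e = v i"
        using noUD[of i] seg(2,5) ie \<open>d ! i \<noteq> Down\<close>
        by (intro cnt_const) (auto simp: length_d le_less)
      then show False
        using v_Lipschitz[of c i] seg(2) dn i(2) by simp
    qed
    moreover have "d ! Suc i = Up"
    proof (rule ccontr)
      assume "d ! Suc i \<noteq> Up"
      then have "d ! Suc i = Down" by (cases "d ! Suc i") auto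
      then have "u (Suc (Suc i)) = u c"
        using noUD[of _ "Suc i"] seg(2,5) ie \<open>d ! Suc i \<noteq> Up\<close>
        by (intro cnt_const) (auto simp: length_d less_Suc_eq_le le_less)
      then show False
        using u_v[of "Suc (Suc i)"] u_v[of c] seg(2) dn up ie seg(5) cnt_mono[of "Suc (Suc i)" e d Down] by simp
    qed
    moreover have "v e = v (Suc i)"
      using noUD[of "Suc i"] seg(2,5) ie \<open>d ! Suc i = Up\<close>
      by (intro cnt_const) (auto simp: length_d le_less)
    ultimately have "z \<in> valleys d"
      using i cb height_from_Down[of ?b "Suc i"] height_from_Down[of d "Suc i"]
      by (auto simp: valleys_def length_d)
    then show ?thesis by blast
  qed
qed

lemma sorted_path_in_B:
  assumes "\<sigma> \<in> M n d"
  shows "sorted_path (nondes \<sigma>) \<in> B n d" "peak_positions (sorted_path (nondes \<sigma>)) = nondes \<sigma>"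
proof -
  let ?A = "nondes \<sigma>"
  have card: "card ?A = bpk d" using assms by (simp add: M_iff)
  have A: "?A \<subseteq> {1..<2 * n}" by (auto simp: nondes_def)
  show pp: "peak_positions (sorted_path ?A) = ?A"
    using peak_positions_sorted_path[OF A critical_interval[OF stabs_nondes card]] .
  have "height (sorted_path ?A) a = height d a" if "a \<in> ?A" for a
    using that A cnt_sorted_path_cut[OF A that] by (auto simp: height_from_Down length_d)
  then have "peaks (sorted_path ?A) \<subseteq> vertices d"
    unfolding peaks_eq_image pp vertices_def using A by (fastforce simp: length_d)
  then show "sorted_path ?A \<in> B n d"
    using dyck_sorted_path[OF stabs_nondes] under_sorted_path[OF A] pp card valleys_sorted_path[OF card]
    by (simp add: B_def pk_eq_card)
qed

section \<open>Paths in \<open>B n d\<close>\<close>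

text \<open>Between consecutive peaks \<open>b\<close> descends to a vertex \<open>z\<close> and
  then rises. As \<open>b\<close> meets \<open>d\<close> at \<open>c\<close> and \<open>e\<close>,
  the up-steps before \<open>z\<close> number \<open>u c\<close> and the down-steps
  \<open>v e\<close>; nonnegative height at \<open>z\<close> then gives
  \<open>v e \<le> u c\<close>.\<close>

lemma B_segment:
  assumes b: "b \<in> B n d" and p: "p < 2 * n"
  defines "c \<equiv> seg_start (peak_positions b) p" and "e \<equiv> seg_end (peak_positions b) p"
  obtains z where "c \<le> z" "z \<le> e" "cnt b Up z = u c" "cnt b Down z = v e"
    "v e \<le> u c" "c < z \<Longrightarrow> z < e \<Longrightarrow> (z, height b z) \<in> valleys b"
    "cnt b Down c = v c" "cnt b Up e = u e"
proof -
  let ?A = "peak_positions b"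
  interpret b: dyck n b using b by unfold_locales (simp add: B_def)
  have A: "?A \<subseteq> {1..<2 * n}" using peak_positions_subset[of b] by (simp add: b.length_d)
  note seg = seg_props[OF A, of p, folded c_def e_def]
  have on_d: "cnt b s x = cnt d s x" if "x \<in> insert 0 (insert (2 * n) ?A)" for x s
  proof (cases "x \<in> ?A")
    case True
    then have "(x, height b x) \<in> vertices d"
      using b by (auto simp: B_def peaks_eq_image)
    then have "height b x = height d x" by (auto simp: vertices_def)
    then show ?thesis
      using A True by (intro cnt_eq_if_height_eq) (auto simp: length_d b.length_d)
  qed (use that in auto)
  have "c < e" "e \<le> 2 * n" using seg p by auto
  then obtain z where z: "c \<le> z" "z \<le> e" and dn: "\<And>j. c \<le> j \<Longrightarrow> j < z \<Longrightarrow> b ! j = Down"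
    and up: "\<And>j. z \<le> j \<Longrightarrow> j < e \<Longrightarrow> b ! j = Up"
    using no_peak_split[of c e b] seg(6) by (auto simp: b.length_d)
  have 1: "cnt b Up z = u c"
    using cnt_const[of c z b Up] z dn on_d[of c] seg(1) \<open>e \<le> 2 * n\<close> by (auto simp: b.length_d)
  have 2: "cnt b Down z = v e"
    using cnt_const[of z e b Down] z up on_d[of e] seg(3) \<open>e \<le> 2 * n\<close> by (auto simp: b.length_d)
  have "(z, height b z) \<in> valleys b" if cz: "c < z" and ze: "z < e"
  proof -
    obtain i where "z = Suc i" using cz by (cases z) auto
    then show ?thesis
      using cz ze dn[of i] up[of z] \<open>e \<le> 2 * n\<close> by (auto simp: valleys_def b.length_d)
  qed
  then show ?thesis
    using that[OF z 1 2] b.v_le_u[of z] 1 2 on_d[of c] on_d[of e] seg(1,3) by auto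
qed

text \<open>An interval without a peak of \<open>b\<close> would lie in one segment, giving
  \<open>u c < i \<le> v e\<close> against \<open>B_segment\<close>.\<close>

lemma peak_positions_stabs:
  assumes b: "b \<in> B n d"
  shows "stabs (peak_positions b)"
proof -
  let ?A = "peak_positions b"
  have A: "?A \<subseteq> {1..<2 * n}"
    using peak_positions_subset[of b] b by (simp add: B_def dyck_path_def)
  have "?A \<inter> {pU i<..pD i} \<noteq> {}" if i: "i \<in> {1..n}" for i
  proof
    assume none: "?A \<inter> {pU i<..pD i} = {}"
    have p: "pU i < 2 * n" using pos_props[OF i] by simp
    let ?c = "seg_start ?A (pU i)" and ?e = "seg_end ?A (pU i)"
    note seg = seg_props[OF A, of "pU i"]
    have "u ?c < i"
      using seg(2) pos_less_iff[OF i, of Up ?c] by simp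
    moreover have "pD i < ?e"
      using none seg(3) seg(4)[OF p] pos_props(1)[OF i, of Down] by (force simp: disjoint_iff)
    then have "i \<le> v ?e"
      using pos_less_iff[OF i, of Down ?e] by simp
    moreover have "v ?e \<le> u ?c"
      using B_segment[OF b p] by blast
    ultimately show False by simp
  qed
  then show ?thesis using A by (simp add: stabs_def)
qed

text \<open>An unsorted segment of \<open>d\<close> forces a valley \<open>z\<close> of
  \<open>b\<close> strictly inside it. If \<open>z\<close> is on the axis then
  \<open>u c = v e\<close>, contradicting \<open>v e < t \<le> u c\<close>; if it is a valley of
  \<open>d\<close>, then \<open>d\<close> itself is sorted in the segment.\<close>

lemma peak_positions_noUD:
  assumes b: "b \<in> B n d"
    and t: "t \<in> {1..n}" and a: "a \<in> peak_positions b" "a' \<in> peak_positions b"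
    and less: "pU t < a" "a \<le> p" "p < q" "q < a'" "a' \<le> pD t"
    and UD: "d ! p = Up" "d ! q = Down"
  shows "peak_positions b \<inter> {p<..q} \<noteq> {}"
proof
  let ?A = "peak_positions b"
  assume none: "?A \<inter> {p<..q} = {}"
  have A: "?A \<subseteq> {1..<2 * n}"
    using peak_positions_subset[of b] b by (simp add: B_def dyck_path_def)
  have q: "q < 2 * n" and p: "p < 2 * n" using A a less by auto
  define c e where "c = seg_start ?A p" and "e = seg_end ?A p"
  note seg = seg_props[OF A, of p, folded c_def e_def]
  have "a < e" "c < a'" using less seg(2) seg(4)[OF p] by auto
  then have ac: "a \<le> c" and ea: "e \<le> a'"
    using seg(6) a by (auto simp: disjoint_iff not_less[symmetric])
  have qe: "q < e"
    using none seg(3) seg(4)[OF p] q by (force simp: disjoint_iff)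
  have u: "u c < u e"
    using cnt_mono[of c p d Up] cnt_mono[of "Suc p" e d Up] cnt_Suc[of p d Up] UD(1) seg(2) seg(4)[OF p] p
    by (simp add: length_d)
  have v: "v q < v e"
    using cnt_mono[of "Suc q" e d Down] cnt_Suc[of q d Down] UD(2) qe q by (simp add: length_d)
  obtain z where z: "c \<le> z" "z \<le> e" "cnt b Up z = u c" "cnt b Down z = v e"
    "c < z \<Longrightarrow> z < e \<Longrightarrow> (z, height b z) \<in> valleys b"
    "cnt b Down c = v c" "cnt b Up e = u e"
    using B_segment[OF b p] unfolding c_def e_def by metis
  have "z \<noteq> c" using z v cnt_mono[of c q d Down] seg(2) less by auto
  moreover have "z \<noteq> e" using z u by auto
  ultimately have "(z, height b z) \<in> valleys b" using z by simp
  then have "(z, height b z) \<in> valleys d \<or> height b z = 0"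
    using b by (fastforce simp: B_def)
  then show False
  proof
    assume "height b z = 0"
    then have "u c = v e" using z by (simp add: height_eq_cnt)
    moreover have "t \<le> u c"
      using pos_less_iff[OF t, of Up c] less(1) ac by simp
    moreover have "v e < t"
      using pos_less_iff[OF t, of Down e] less(5) ea by simp
    ultimately show False by simp
  next
    assume "(z, height b z) \<in> valleys d"
    then have h: "height b z = height d z" by (auto simp: valleys_def)
    have "z \<le> 2 * n" using z(2) seg(5) by simp
    moreover have "length b = 2 * n" using b by (simp add: B_def dyck_path_def)
    ultimately have eq: "cnt b s z = cnt d s z" for s
      using h by (intro cnt_eq_if_height_eq) (simp_all add: length_d)
    \<comment> \<open>Since \<open>u z = u c\<close>, the up-step \<open>p\<close> cannot precede
      \<open>z\<close>; since \<open>v z = v e\<close>, the down-step \<open>q\<close> cannot follow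
      it.\<close>
    have "z \<le> p"
    proof (rule ccontr)
      assume "\<not> z \<le> p"
      then have "u (Suc p) \<le> u z" by (intro cnt_mono) simp
      then show False
        using cnt_mono[OF seg(2), of d Up] cnt_Suc[of p d Up] UD(1) p z eq[of Up] by (simp add: length_d)
    qed
    then show False
      using cnt_mono[of z q d Down] less(3) v z eq[of Down] by simp
  qed
qed

text \<open>Realization only gives inclusion of the non-descents in the peak positions; both sets
  having to reach \<open>bpk d\<close> elements turns it into equality.\<close>

lemma B_realized:
  assumes b: "b \<in> B n d"
  obtains \<sigma> where "\<sigma> \<in> M n d" "nondes \<sigma> = peak_positions b"
proof -
  let ?A = "peak_positions b"
  obtain \<sigma> where \<sigma>: "\<sigma> permutes {1..n}" "nondes \<sigma> \<subseteq> ?A"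
    using nondes_realizable[OF peak_positions_stabs[OF b]] peak_positions_noUD[OF b] by metis
  have "card ?A = bpk d" using b by (simp add: B_def pk_eq_card)
  then have "nondes \<sigma> = ?A"
    using \<sigma>(2) bpk_le_card[OF stabs_nondes, of \<sigma>] by (intro card_seteq) auto
  then show ?thesis
    using that \<sigma>(1) \<open>card ?A = bpk d\<close> by (simp add: M_iff)
qed

end

theorem theorem6p3:
  fixes n :: nat and d :: path
  assumes "dyck_path n d"
  shows "{Des d \<sigma> | \<sigma>. \<sigma> \<in> M n d} = {Des b (decreasing_perm n) | b. b \<in> B n d}"
proof -
  interpret dyck n d using assms by unfold_locales
  have Des_b: "Des b (decreasing_perm n) = {1..<2 * n} - peak_positions b" if "b \<in> B n d" for b
    using that by (intro dyck.Des_decreasing_perm dyck.intro) (simp add: B_def)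
  show ?thesis
  \<comment> \<open>Both families consist of complements in \<open>{1..<2 * n}\<close>, of
    \<open>nondes \<sigma>\<close> and of \<open>peak_positions b\<close>, so it suffices to match
    these sets.\<close>
  proof (intro equalityI subsetI)
    fix X assume "X \<in> {Des d \<sigma> | \<sigma>. \<sigma> \<in> M n d}"
    then obtain \<sigma> where "\<sigma> \<in> M n d" "X = {1..<2 * n} - nondes \<sigma>"
      by (auto simp: Des_eq_nondes)
    then show "X \<in> {Des b (decreasing_perm n) | b. b \<in> B n d}"
      using sorted_path_in_B[of \<sigma>] Des_b[of "sorted_path (nondes \<sigma>)"]
      by (auto intro!: exI[of _ "sorted_path (nondes \<sigma>)"])
  next
    fix X assume "X \<in> {Des b (decreasing_perm n) | b. b \<in> B n d}"
    then obtain b where b: "b \<in> B n d" "X = {1..<2 * n} - peak_positions b"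
      using Des_b by auto
    obtain \<sigma> where "\<sigma> \<in> M n d" "nondes \<sigma> = peak_positions b"
      using B_realized[OF b(1)] by blast
    then show "X \<in> {Des d \<sigma> | \<sigma>. \<sigma> \<in> M n d}"
      using b(2) Des_eq_nondes by blast
  qed
qed

end
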